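(* Let $M$ be a quasiminimal structure, let $p(x)\in S_1(M)$ be its generic type, and suppose that $(M,\operatorname{ccl})$ is a pregeometry. Then $p$ is countably based and symmetric. Moreover, as a base set one can choose some infinite, countable, $\operatorname{ccl}$-free sequence; i.e. there is an infinite countable $\operatorname{ccl}$-free sequence $I\subset M$ such that $p$ is based on $I$.
   Context: Quasiminimal: $M$ is an uncountable one-sorted structure in a countable language such that every subset of $M$ definable with parameters is countable or co-countable. The generic type $p(x)\in S_1(M)$ consists of all formulas with parameters in $M$ defining a co-countable subset of $M$. For $X\subseteq M$: $\operatorname{cl}_p(X)=\{a\in M: a\not\models p|X\}$, and $\operatorname{ccl}(X)=\bigcup_n\operatorname{cl}_p^n(X)$ (iterates of $\operatorname{cl}_p$); this is a closure operator on $M$. $(M,\operatorname{ccl})$ is a pregeometry if $\operatorname{ccl}$ also satisfies exchange: $a\in\operatorname{ccl}(X\cup\{b\})\setminus\operatorname{ccl}(X)$ implies $b\in\operatorname{ccl}(X\cup\{a\})$. A sequence $(a_i:i<\alpha)$ is $\operatorname{ccl}$-free if $a_i\notin\operatorname{ccl}(\{a_j:j<i\})$ for all $i<\alpha$. $p$ does not split over $A$ if $(\phi(x,\bar b_1)\leftrightarrow\phi(x,\bar b_2))\in p$ for all $\phi(x,\bar y)$ over $A$ and all $\bar b_1,\bar b_2\in M$ with the same type over $A$. $p$ is based on $A\subset M$ if $p$ does not split over $A$ and $\operatorname{ccl}(A\cup C)\subsetneq M$ for all finite $C\subset M$; countably based means based on some countable $A\subset M$. A weak Morley sequence in $p$ over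 $A$ (where $p$ does not split over $A$) is a sequence $(a_i)$ from $M$ with $a_i\models p|(A\cup\{a_j:j<i\})$ for all $i$. Here $p$ symmetric means: whenever $p$ is based on $A$, every weak Morley sequence in $p$ over $A$ is totally indiscernible over $A$. *)

theory Defs
  imports Main "HOL-Library.Countable_Set"
begin

section \<open>First-order logic with parameters\<close>

record ('f, 'r) language =
  fun_syms :: "'f set"
  fun_arity :: "'f \<Rightarrow> nat"
  rel_syms :: "'r set"
  rel_arity :: "'r \<Rightarrow> nat"

definition countable_language :: "('f, 'r) language \<Rightarrow> bool" where
  "countable_language L \<longleftrightarrow> countable (fun_syms L) \<and> countable (rel_syms L)"

text \<open>
  The universe of a structure is the type \<open>'m\<close>. Interpretations are only ever consulted at
  symbols of the language and at argument lists of the right length.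
\<close>

record ('f, 'r, 'm) struct =
  fun_interp :: "'f \<Rightarrow> 'm list \<Rightarrow> 'm"
  rel_interp :: "'r \<Rightarrow> 'm list \<Rightarrow> bool"

text \<open>
  Terms and formulas of the language expanded by a constant \<open>Param m\<close> for each element \<open>m\<close>.
  Formulas over \<open>A\<close> are those whose parameters lie in \<open>A\<close>; variables are named by numbers.
\<close>

datatype ('f, 'm) tm = Var nat | Param 'm | Fn 'f "('f, 'm) tm list"

datatype ('f, 'r, 'm) fm =
    FEq "('f, 'm) tm" "('f, 'm) tm"
  | FRel 'r "('f, 'm) tm list"
  | FNeg "('f, 'r, 'm) fm"
  | FConj "('f, 'r, 'm) fm" "('f, 'r, 'm) fm"
  | FAll nat "('f, 'r, 'm) fm"

definition FIff :: "('f, 'r, 'm) fm \<Rightarrow> ('f, 'r, 'm) fm \<Rightarrow> ('f, 'r, 'm) fm" where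
  "FIff \<phi> \<psi> = FConj (FNeg (FConj \<phi> (FNeg \<psi>))) (FNeg (FConj \<psi> (FNeg \<phi>)))"

fun wf_tm :: "('f, 'r) language \<Rightarrow> ('f, 'm) tm \<Rightarrow> bool" where
  "wf_tm L (Var n) \<longleftrightarrow> True"
| "wf_tm L (Param m) \<longleftrightarrow> True"
| "wf_tm L (Fn f ts) \<longleftrightarrow>
     f \<in> fun_syms L \<and> length ts = fun_arity L f \<and> (\<forall>t\<in>set ts. wf_tm L t)"

fun wf_fm :: "('f, 'r) language \<Rightarrow> ('f, 'r, 'm) fm \<Rightarrow> bool" where
  "wf_fm L (FEq s t) \<longleftrightarrow> wf_tm L s \<and> wf_tm L t"
| "wf_fm L (FRel R ts) \<longleftrightarrow>
     R \<in> rel_syms L \<and> length ts = rel_arity L R \<and> (\<forall>t\<in>set ts. wf_tm L t)"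
| "wf_fm L (FNeg \<phi>) \<longleftrightarrow> wf_fm L \<phi>"
| "wf_fm L (FConj \<phi> \<psi>) \<longleftrightarrow> wf_fm L \<phi> \<and> wf_fm L \<psi>"
| "wf_fm L (FAll n \<phi>) \<longleftrightarrow> wf_fm L \<phi>"

fun fv_tm :: "('f, 'm) tm \<Rightarrow> nat set" where
  "fv_tm (Var n) = {n}"
| "fv_tm (Param m) = {}"
| "fv_tm (Fn f ts) = (\<Union>t\<in>set ts. fv_tm t)"

fun fv :: "('f, 'r, 'm) fm \<Rightarrow> nat set" where
  "fv (FEq s t) = fv_tm s \<union> fv_tm t"
| "fv (FRel R ts) = (\<Union>t\<in>set ts. fv_tm t)"
| "fv (FNeg \<phi>) = fv \<phi>"
| "fv (FConj \<phi> \<psi>) = fv \<phi> \<union> fv \<psi>"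
| "fv (FAll n \<phi>) = fv \<phi> - {n}"

fun params_tm :: "('f, 'm) tm \<Rightarrow> 'm set" where
  "params_tm (Var n) = {}"
| "params_tm (Param m) = {m}"
| "params_tm (Fn f ts) = (\<Union>t\<in>set ts. params_tm t)"

fun params :: "('f, 'r, 'm) fm \<Rightarrow> 'm set" where
  "params (FEq s t) = params_tm s \<union> params_tm t"
| "params (FRel R ts) = (\<Union>t\<in>set ts. params_tm t)"
| "params (FNeg \<phi>) = params \<phi>"
| "params (FConj \<phi> \<psi>) = params \<phi> \<union> params \<psi>"
| "params (FAll n \<phi>) = params \<phi>"

fun eval_tm :: "('f, 'r, 'm) struct \<Rightarrow> (nat \<Rightarrow> 'm) \<Rightarrow> ('f, 'm) tm \<Rightarrow> 'm" where
  "eval_tm M e (Var n) = e n"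
| "eval_tm M e (Param m) = m"
| "eval_tm M e (Fn f ts) = fun_interp M f (map (eval_tm M e) ts)"

fun sat :: "('f, 'r, 'm) struct \<Rightarrow> (nat \<Rightarrow> 'm) \<Rightarrow> ('f, 'r, 'm) fm \<Rightarrow> bool" where
  "sat M e (FEq s t) \<longleftrightarrow> eval_tm M e s = eval_tm M e t"
| "sat M e (FRel R ts) \<longleftrightarrow> rel_interp M R (map (eval_tm M e) ts)"
| "sat M e (FNeg \<phi>) \<longleftrightarrow> \<not> sat M e \<phi>"
| "sat M e (FConj \<phi> \<psi>) \<longleftrightarrow> sat M e \<phi> \<and> sat M e \<psi>"
| "sat M e (FAll n \<phi>) \<longleftrightarrow> (\<forall>a. sat M (e(n := a)) \<phi>)"

text \<open>
  Replacing free variables by parameters; bound variables are left alone. As parameters are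
  closed terms, no variable can be captured.
\<close>

fun inst_tm :: "(nat \<Rightarrow> 'm option) \<Rightarrow> ('f, 'm) tm \<Rightarrow> ('f, 'm) tm" where
  "inst_tm \<sigma> (Var n) = (case \<sigma> n of None \<Rightarrow> Var n | Some m \<Rightarrow> Param m)"
| "inst_tm \<sigma> (Param m) = Param m"
| "inst_tm \<sigma> (Fn f ts) = Fn f (map (inst_tm \<sigma>) ts)"

fun inst :: "(nat \<Rightarrow> 'm option) \<Rightarrow> ('f, 'r, 'm) fm \<Rightarrow> ('f, 'r, 'm) fm" where
  "inst \<sigma> (FEq s t) = FEq (inst_tm \<sigma> s) (inst_tm \<sigma> t)"
| "inst \<sigma> (FRel R ts) = FRel R (map (inst_tm \<sigma>) ts)"
| "inst \<sigma> (FNeg \<phi>) = FNeg (inst \<sigma> \<phi>)"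
| "inst \<sigma> (FConj \<phi> \<psi>) = FConj (inst \<sigma> \<phi>) (inst \<sigma> \<psi>)"
| "inst \<sigma> (FAll n \<phi>) = FAll n (inst (\<sigma>(n := None)) \<phi>)"

text \<open>
  In \<open>\<phi>(x, y\<^sub>1, \<dots>, y\<^sub>n)\<close> the variable \<open>x\<close> is number 0 and \<open>y\<^sub>i\<close> is number \<open>i\<close>;
  \<open>inst_y bs \<phi>\<close> is \<open>\<phi>(x, bs)\<close>.
\<close>

definition inst_y :: "'m list \<Rightarrow> ('f, 'r, 'm) fm \<Rightarrow> ('f, 'r, 'm) fm" where
  "inst_y bs = inst (\<lambda>i. case i of 0 \<Rightarrow> None
                           | Suc j \<Rightarrow> if j < length bs then Some (bs ! j) else None)"

text \<open>\<open>tp L M A bs\<close> is the type of the tuple \<open>bs\<close> over \<open>A\<close>, in the variables below \<open>length bs\<close>.\<close>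

definition tp :: "('f, 'r) language \<Rightarrow> ('f, 'r, 'm) struct \<Rightarrow> 'm set \<Rightarrow> 'm list
    \<Rightarrow> ('f, 'r, 'm) fm set" where
  "tp L M A bs = {\<phi>. wf_fm L \<phi> \<and> params \<phi> \<subseteq> A \<and> fv \<phi> \<subseteq> {..<length bs} \<and>
     sat M (\<lambda>i. if i < length bs then bs ! i else undefined) \<phi>}"


section \<open>Quasiminimal structures and the generic type\<close>

definition fm1 :: "('f, 'r) language \<Rightarrow> ('f, 'r, 'm) fm set" where
  "fm1 L = {\<phi>. wf_fm L \<phi> \<and> fv \<phi> \<subseteq> {0}}"

definition defined_set :: "('f, 'r, 'm) struct \<Rightarrow> ('f, 'r, 'm) fm \<Rightarrow> 'm set" where
  "defined_set M \<phi> = {a. sat M (\<lambda>_. a) \<phi>}"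

definition definable :: "('f, 'r) language \<Rightarrow> ('f, 'r, 'm) struct \<Rightarrow> 'm set \<Rightarrow> bool" where
  "definable L M X \<longleftrightarrow> (\<exists>\<phi>\<in>fm1 L. X = defined_set M \<phi>)"

definition quasiminimal :: "('f, 'r) language \<Rightarrow> ('f, 'r, 'm) struct \<Rightarrow> bool" where
  "quasiminimal L M \<longleftrightarrow> countable_language L \<and> uncountable (UNIV :: 'm set) \<and>
     (\<forall>X. definable L M X \<longrightarrow> countable X \<or> countable (- X))"

definition generic_type :: "('f, 'r) language \<Rightarrow> ('f, 'r, 'm) struct \<Rightarrow> ('f, 'r, 'm) fm set" where
  "generic_type L M = {\<phi> \<in> fm1 L. countable (- defined_set M \<phi>)}"


section \<open>The closure operator of a type\<close>

definition restrict_type :: "('f, 'r, 'm) fm set \<Rightarrow> 'm set \<Rightarrow> ('f, 'r, 'm) fm set" where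
  "restrict_type p X = {\<phi> \<in> p. params \<phi> \<subseteq> X}"

definition realizes :: "('f, 'r, 'm) struct \<Rightarrow> 'm \<Rightarrow> ('f, 'r, 'm) fm set \<Rightarrow> bool" where
  "realizes M a q \<longleftrightarrow> (\<forall>\<phi>\<in>q. a \<in> defined_set M \<phi>)"

definition cl :: "('f, 'r, 'm) struct \<Rightarrow> ('f, 'r, 'm) fm set \<Rightarrow> 'm set \<Rightarrow> 'm set" where
  "cl M p X = {a. \<not> realizes M a (restrict_type p X)}"

definition ccl :: "('f, 'r, 'm) struct \<Rightarrow> ('f, 'r, 'm) fm set \<Rightarrow> 'm set \<Rightarrow> 'm set" where
  "ccl M p X = (\<Union>n. (cl M p ^^ n) X)"

definition closure_operator :: "('m set \<Rightarrow> 'm set) \<Rightarrow> bool" where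
  "closure_operator c \<longleftrightarrow>
     (\<forall>X. X \<subseteq> c X) \<and> (\<forall>X Y. X \<subseteq> Y \<longrightarrow> c X \<subseteq> c Y) \<and> (\<forall>X. c (c X) = c X) \<and>
     (\<forall>X. c X = (\<Union>F\<in>{F. finite F \<and> F \<subseteq> X}. c F))"

definition pregeometry :: "('m set \<Rightarrow> 'm set) \<Rightarrow> bool" where
  "pregeometry c \<longleftrightarrow> closure_operator c \<and>
     (\<forall>X a b. a \<in> c (insert b X) - c X \<longrightarrow> b \<in> c (insert a X))"


section \<open>Sequences\<close>

text \<open>
  A sequence \<open>(a\<^sub>i : i < \<alpha>)\<close> is given by a well-order \<open>r\<close> and the values of \<open>a\<close> on \<open>Field r\<close>;
  \<open>underS r i\<close> is the set of indices strictly below \<open>i\<close>.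
\<close>

definition ccl_free :: "('f, 'r, 'm) struct \<Rightarrow> ('f, 'r, 'm) fm set \<Rightarrow> 'i rel \<Rightarrow> ('i \<Rightarrow> 'm)
    \<Rightarrow> bool" where
  "ccl_free M p r a \<longleftrightarrow> Well_order r \<and> (\<forall>i\<in>Field r. a i \<notin> ccl M p (a ` underS r i))"

definition does_not_split :: "('f, 'r) language \<Rightarrow> ('f, 'r, 'm) struct \<Rightarrow> ('f, 'r, 'm) fm set
    \<Rightarrow> 'm set \<Rightarrow> bool" where
  "does_not_split L M p A \<longleftrightarrow>
     (\<forall>n \<phi> b1 b2. wf_fm L \<phi> \<and> params \<phi> \<subseteq> A \<and> fv \<phi> \<subseteq> {..n} \<and>
        length b1 = n \<and> length b2 = n \<and> tp L M A b1 = tp L M A b2 \<longrightarrow>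
        FIff (inst_y b1 \<phi>) (inst_y b2 \<phi>) \<in> p)"

definition based_on :: "('f, 'r) language \<Rightarrow> ('f, 'r, 'm) struct \<Rightarrow> ('f, 'r, 'm) fm set
    \<Rightarrow> 'm set \<Rightarrow> bool" where
  "based_on L M p A \<longleftrightarrow> does_not_split L M p A \<and>
     (\<forall>C. finite C \<longrightarrow> ccl M p (A \<union> C) \<subset> UNIV)"

definition countably_based :: "('f, 'r) language \<Rightarrow> ('f, 'r, 'm) struct \<Rightarrow> ('f, 'r, 'm) fm set
    \<Rightarrow> bool" where
  "countably_based L M p \<longleftrightarrow> (\<exists>A. countable A \<and> based_on L M p A)"

definition weak_Morley :: "('f, 'r) language \<Rightarrow> ('f, 'r, 'm) struct \<Rightarrow> ('f, 'r, 'm) fm set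
    \<Rightarrow> 'm set \<Rightarrow> 'i rel \<Rightarrow> ('i \<Rightarrow> 'm) \<Rightarrow> bool" where
  "weak_Morley L M p A r a \<longleftrightarrow> does_not_split L M p A \<and> Well_order r \<and>
     (\<forall>i\<in>Field r. realizes M (a i) (restrict_type p (A \<union> a ` underS r i)))"

definition totally_indiscernible :: "('f, 'r) language \<Rightarrow> ('f, 'r, 'm) struct \<Rightarrow> 'm set
    \<Rightarrow> 'i rel \<Rightarrow> ('i \<Rightarrow> 'm) \<Rightarrow> bool" where
  "totally_indiscernible L M A r a \<longleftrightarrow>
     (\<forall>is js. set is \<subseteq> Field r \<and> set js \<subseteq> Field r \<and> distinct is \<and> distinct js \<and>
        length is = length js \<longrightarrow> tp L M A (map a is) = tp L M A (map a js))"

text \<open>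
  Index sets may be taken inside \<open>'m\<close>: below, \<open>p\<close> is the generic type, which contains
  \<open>x \<noteq> b\<close> for every \<open>b\<close>. Weak Morley sequences are therefore injective, so that their
  lengths are order types of well-ordered subsets of \<open>'m\<close>.
\<close>

definition symmetric_type :: "('f, 'r) language \<Rightarrow> ('f, 'r, 'm) struct \<Rightarrow> ('f, 'r, 'm) fm set
    \<Rightarrow> bool" where
  "symmetric_type L M p \<longleftrightarrow>
     (\<forall>A (r :: 'm rel) a. based_on L M p A \<and> weak_Morley L M p A r a \<longrightarrow>
        totally_indiscernible L M A r a)"


section \<open>Basic facts\<close>

lemma finite_params_tm: "finite (params_tm t)"
  by (induction t) auto

lemma finite_params: "finite (params \<phi>)"
  by (induction \<phi>) (auto simp: finite_params_tm)

lemma mem_cl_iff: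
  "a \<in> cl M p X \<longleftrightarrow> (\<exists>\<phi>\<in>p. params \<phi> \<subseteq> X \<and> a \<notin> defined_set M \<phi>)"
  by (auto simp: cl_def realizes_def restrict_type_def)

lemma cl_mono: "X \<subseteq> Y \<Longrightarrow> cl M p X \<subseteq> cl M p Y"
  by (meson mem_cl_iff order_trans subsetI)

lemma cl_generic_extensive: "X \<subseteq> cl M (generic_type L M) X"
proof
  fix a assume a: "a \<in> X"
  let ?\<phi> = "FNeg (FEq (Var 0) (Param a))"
  have "- defined_set M ?\<phi> = {a}"
    by (auto simp: defined_set_def)
  then have "?\<phi> \<in> generic_type L M"
    by (simp add: generic_type_def fm1_def)
  moreover have "a \<notin> defined_set M ?\<phi>"
    by (simp add: defined_set_def)
  ultimately show "a \<in> cl M (generic_type L M) X"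
    using a by (subst mem_cl_iff) (rule bexI[of _ ?\<phi>], auto)
qed

lemma funpow_cl_mono: "X \<subseteq> Y \<Longrightarrow> (cl M p ^^ n) X \<subseteq> (cl M p ^^ n) Y"
  by (induction n) (auto dest: cl_mono)

lemma funpow_cl_generic_le:
  assumes "m \<le> n"
  shows "(cl M (generic_type L M) ^^ m) X \<subseteq> (cl M (generic_type L M) ^^ n) X"
  using assms
proof (induction n rule: dec_induct)
  case (step n)
  have "(cl M (generic_type L M) ^^ n) X \<subseteq> (cl M (generic_type L M) ^^ Suc n) X"
    using cl_generic_extensive by simp
  with step.IH show ?case by (rule order_trans)
qed simp

lemma finite_subset_funpow_cl:
  assumes "finite F" "F \<subseteq> ccl M (generic_type L M) X"
  shows "\<exists>n. F \<subseteq> (cl M (generic_type L M) ^^ n) X"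
  using assms
proof (induction F)
  case (insert a F)
  then obtain m n where "a \<in> (cl M (generic_type L M) ^^ m) X"
    and "F \<subseteq> (cl M (generic_type L M) ^^ n) X"
    by (auto simp: ccl_def)
  then have "insert a F \<subseteq> (cl M (generic_type L M) ^^ max m n) X"
    using funpow_cl_generic_le[of m "max m n"] funpow_cl_generic_le[of n "max m n"]
    by (meson insert_subsetI max.cobounded1 max.cobounded2 order_trans subsetD)
  then show ?case by blast
qed simp

lemma cl_ccl_subset:
  "cl M (generic_type L M) (ccl M (generic_type L M) X) \<subseteq> ccl M (generic_type L M) X"
proof
  fix a assume "a \<in> cl M (generic_type L M) (ccl M (generic_type L M) X)"
  then obtain \<phi> where \<phi>: "\<phi> \<in> generic_type L M" "a \<notin> defined_set M \<phi>"
    and "params \<phi> \<subseteq> ccl M (generic_type L M) X"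
    by (auto simp: mem_cl_iff)
  then obtain n where "params \<phi> \<subseteq> (cl M (generic_type L M) ^^ n) X"
    using finite_subset_funpow_cl finite_params by meson
  then have "a \<in> (cl M (generic_type L M) ^^ Suc n) X"
    using \<phi> by (auto simp: mem_cl_iff)
  then show "a \<in> ccl M (generic_type L M) X"
    unfolding ccl_def by blast
qed

lemma funpow_cl_finitary:
  "a \<in> (cl M p ^^ n) X \<Longrightarrow> \<exists>F. finite F \<and> F \<subseteq> X \<and> a \<in> (cl M p ^^ n) F"
proof (induction n arbitrary: a)
  case 0
  then show ?case by (intro exI[of _ "{a}"]) auto
next
  case (Suc n)
  then obtain \<phi> where \<phi>: "\<phi> \<in> p" "a \<notin> defined_set M \<phi>" "params \<phi> \<subseteq> (cl M p ^^ n) X"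
    by (auto simp: mem_cl_iff)
  then have "\<forall>b\<in>params \<phi>. \<exists>F. finite F \<and> F \<subseteq> X \<and> b \<in> (cl M p ^^ n) F"
    using Suc.IH by blast
  then obtain G where G: "\<And>b. b \<in> params \<phi> \<Longrightarrow> finite (G b) \<and> G b \<subseteq> X \<and> b \<in> (cl M p ^^ n) (G b)"
    by metis
  let ?F = "\<Union>b\<in>params \<phi>. G b"
  have "params \<phi> \<subseteq> (cl M p ^^ n) ?F"
    using G funpow_cl_mono[of "G _" ?F n] by blast
  then have "a \<in> (cl M p ^^ Suc n) ?F"
    using \<phi> by (auto simp: mem_cl_iff)
  moreover have "finite ?F" "?F \<subseteq> X"
    using G finite_params by auto
  ultimately show ?case by blast
qed

text \<open>Hence in \<^const>\<open>pregeometry\<close> only exchange is a condition on \<open>ccl\<close> of the generic type.\<close>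

lemma closure_operator_ccl: "closure_operator (ccl M (generic_type L M))"
proof -
  let ?p = "generic_type L M"
  have ext: "X \<subseteq> ccl M ?p X" for X
    unfolding ccl_def by (metis UNIV_I UN_upper funpow_0)
  have mono: "ccl M ?p X \<subseteq> ccl M ?p Y" if "X \<subseteq> Y" for X Y
    unfolding ccl_def using funpow_cl_mono[OF that] by blast
  have "(cl M ?p ^^ n) (ccl M ?p X) \<subseteq> ccl M ?p X" for n X
  proof (induction n)
    case (Suc n)
    have "(cl M ?p ^^ Suc n) (ccl M ?p X) \<subseteq> cl M ?p (ccl M ?p X)"
      using cl_mono[OF Suc.IH] by simp
    then show ?case using cl_ccl_subset by (rule order_trans)
  qed simp
  then have idem: "ccl M ?p (ccl M ?p X) = ccl M ?p X" for X
    using ext[of "ccl M ?p X"] unfolding ccl_def[of M ?p "ccl M ?p X"] by blast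
  have "ccl M ?p X = (\<Union>F\<in>{F. finite F \<and> F \<subseteq> X}. ccl M ?p F)" for X
  proof
    show "ccl M ?p X \<subseteq> (\<Union>F\<in>{F. finite F \<and> F \<subseteq> X}. ccl M ?p F)"
    proof
      fix a assume "a \<in> ccl M ?p X"
      then obtain n where "a \<in> (cl M ?p ^^ n) X"
        unfolding ccl_def by blast
      then obtain F where "finite F" "F \<subseteq> X" "a \<in> (cl M ?p ^^ n) F"
        using funpow_cl_finitary by meson
      then show "a \<in> (\<Union>F\<in>{F. finite F \<and> F \<subseteq> X}. ccl M ?p F)"
        unfolding ccl_def by blast
    qed
    show "(\<Union>F\<in>{F. finite F \<and> F \<subseteq> X}. ccl M ?p F) \<subseteq> ccl M ?p X"
      using mono by blast
  qed
  with ext mono idem show ?thesis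
    unfolding closure_operator_def by blast
qed

end

theory Submission
  imports Defs "HOL-Combinatorics.Permutations"
begin

text \<open>
  An element outside \<open>ccl X\<close> realizes \<open>p|X\<close>. A finite set never spans an infinite independent
  set \<open>I\<close>, so for any two tuples \<open>b\<^sub>1, b\<^sub>2\<close> some \<open>e \<in> I\<close> realizes \<open>p\<close> over both; if the
  tuples have the same type over \<open>I\<close>, then \<open>\<phi>(e, b\<^sub>1) \<longleftrightarrow> \<phi>(e, b\<^sub>2)\<close>, and by genericity of \<open>e\<close>
  the equivalence lies in \<open>p\<close>. Hence \<open>p\<close> does not split over \<open>I\<close>.
  For symmetry, non-splitting over \<open>A\<close> makes all finite weak Morley sequences over \<open>A\<close> of a given
  length have the same type over \<open>A\<close>. Among them are the sequences independent over \<open>A\<close>, which by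
  exchange remain independent, hence weak Morley, under every permutation.
\<close>

section \<open>Pregeometries\<close>

text \<open>Independence is a property of the set, without reference to an enumeration, so it
  survives every permutation of a tuple.\<close>

definition indep_over :: "('m set \<Rightarrow> 'm set) \<Rightarrow> 'm set \<Rightarrow> 'm set \<Rightarrow> bool" where
  "indep_over c A B \<longleftrightarrow> (\<forall>x\<in>B. x \<notin> c (A \<union> (B - {x})))"

context
  fixes c :: "'m set \<Rightarrow> 'm set"
  assumes pregeometry: "pregeometry c"
begin

lemma pregeometry_closure_operator: "closure_operator c"
  using pregeometry unfolding pregeometry_def by (rule conjunct1)

lemma pregeometry_extensive: "X \<subseteq> c X"
  and pregeometry_mono: "X \<subseteq> Y \<Longrightarrow> c X \<subseteq> c Y"
  and pregeometry_idem: "c (c X) = c X"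
  using pregeometry_closure_operator unfolding closure_operator_def by metis+

lemma pregeometry_finitary:
  assumes "a \<in> c X"
  shows "\<exists>F. finite F \<and> F \<subseteq> X \<and> a \<in> c F"
proof -
  have "c X = (\<Union>F\<in>{F. finite F \<and> F \<subseteq> X}. c F)"
    using pregeometry_closure_operator unfolding closure_operator_def by (elim conjE) (rule spec)
  with assms have "a \<in> (\<Union>F\<in>{F. finite F \<and> F \<subseteq> X}. c F)" by (rule subst[rotated])
  then show ?thesis by blast
qed

lemma pregeometry_exchange: "a \<in> c (insert b X) \<Longrightarrow> a \<notin> c X \<Longrightarrow> b \<in> c (insert a X)"
  using pregeometry unfolding pregeometry_def by blast

lemma pregeometry_trans: "a \<in> c (insert b X) \<Longrightarrow> b \<in> c X \<Longrightarrow> a \<in> c X"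
  using pregeometry_mono[of "insert b X" "c X"] pregeometry_extensive[of X] pregeometry_idem[of X]
  by auto

text \<open>If some \<open>x\<close> in \<open>B\<close> became dependent on the rest once
  \<open>b\<close> is added, exchange would put \<open>b\<close> into
  \<open>c (A \<union> B)\<close>.\<close>

lemma indep_over_insert:
  assumes "indep_over c A B" "b \<notin> c (A \<union> B)"
  shows "indep_over c A (insert b B)"
  unfolding indep_over_def
proof
  fix x assume x: "x \<in> insert b B"
  have "b \<notin> B"
    using assms(2) pregeometry_extensive by blast
  show "x \<notin> c (A \<union> (insert b B - {x}))"
  proof (cases "x = b")
    case True
    then show ?thesis using assms(2) \<open>b \<notin> B\<close> by simp
  next
    case False
    then have "x \<in> B" using x by simp
    have eq: "A \<union> (insert b B - {x}) = insert b (A \<union> (B - {x}))"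
      "insert x (A \<union> (B - {x})) = A \<union> B"
      using False \<open>x \<in> B\<close> by auto
    show ?thesis
      using pregeometry_exchange[of x b "A \<union> (B - {x})"] assms \<open>x \<in> B\<close>
      unfolding eq indep_over_def by blast
  qed
qed

text \<open>Steinitz's argument: moving one element of \<open>F\<close> into \<open>A\<close> costs at most one element of \<open>B\<close>.\<close>

lemma infinite_indep_not_spanned:
  assumes "finite F" "infinite B" "indep_over c A B"
  shows "\<not> B \<subseteq> c (A \<union> F)"
  using assms
proof (induction F arbitrary: A B)
  case empty
  then obtain x where "x \<in> B" by fastforce
  then show ?case
    using empty pregeometry_mono[of A "A \<union> (B - {x})"] by (auto simp: indep_over_def)
next
  case (insert f F)
  have eq: "A \<union> insert f F = insert f A \<union> F" by simp
  show ?case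
  proof (cases "indep_over c (insert f A) B")
    case True
    then show ?thesis using insert unfolding eq by blast
  next
    case False
    then obtain x where x: "x \<in> B" "x \<in> c (insert f (A \<union> (B - {x})))"
      by (auto simp: indep_over_def)
    have "indep_over c (insert f A) (B - {x})"
      unfolding indep_over_def
    proof
      fix y assume y: "y \<in> B - {x}"
      let ?C = "A \<union> (B - {x} - {y})"
      have "y \<notin> c ?C"
        using insert.prems(2) y pregeometry_mono[of ?C "A \<union> (B - {y})"]
        by (auto simp: indep_over_def)
      moreover have "insert y ?C = A \<union> (B - {x})" using y by auto
      \<comment> \<open>Otherwise exchange puts \<open>f\<close> into the closure of
        \<open>A \<union> (B - {x})\<close>, and \<open>x\<close> follows, against independence of
        \<open>B\<close> over \<open>A\<close>.\<close>
      ultimately have "y \<notin> c (insert f ?C)"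
        using pregeometry_exchange[of y f ?C] pregeometry_trans[OF x(2)] insert.prems(2) x(1)
        by (auto simp: indep_over_def)
      then show "y \<notin> c (insert f A \<union> (B - {x} - {y}))" by simp
    qed
    moreover have "infinite (B - {x})" using insert.prems(1) by simp
    ultimately show ?thesis using insert.IH unfolding eq by blast
  qed
qed

text \<open>Freeness compares an element only with earlier ones. Exchange makes every initial
  segment independent, and by finite character a dependence in the range already occurs in an
  initial segment.\<close>

lemma free_sequence_indep:
  fixes e :: "nat \<Rightarrow> 'm"
  assumes free: "\<And>n. e n \<notin> c (e ` {..<n})"
  shows "inj e" "indep_over c {} (range e)"
proof -
  have *: "e m \<noteq> e n" if "m < n" for m n
    using free[of n] pregeometry_extensive[of "e ` {..<n}"] that by force
  then show inj: "inj e"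
    by (metis injI linorder_neq_iff)
  have fin: "indep_over c {} (e ` {..<n})" for n
  proof (induction n)
    case (Suc n)
    then show ?case
      using indep_over_insert[of "{}" "e ` {..<n}" "e n"] free[of n] by (simp add: lessThan_Suc)
  qed (simp add: indep_over_def)
  show "indep_over c {} (range e)"
    unfolding indep_over_def
  proof (intro ballI notI)
    fix x assume x: "x \<in> range e" and "x \<in> c ({} \<union> (range e - {x}))"
    then obtain F where F: "finite F" "F \<subseteq> range e - {x}" "x \<in> c F"
      using pregeometry_finitary by force
    obtain i where i: "x = e i" using x by blast
    obtain J where J: "finite J" "F = e ` J"
      using F finite_subset_image[of F e UNIV] by auto
    obtain n where n: "insert i J \<subseteq> {..<n}"
      using J(1) finite_nat_bounded[of "insert i J"] by auto
    have "F \<subseteq> e ` {..<n} - {x}" using F(2) J n by auto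
    then have "x \<in> c ({} \<union> (e ` {..<n} - {x}))"
      using F(3) pregeometry_mono by auto
    then show False using fin[of n] i n by (auto simp: indep_over_def)
  qed
qed

text \<open>The hypothesis comes from the second clause of \<open>based_on\<close>: some element
  always lies outside the closure of \<open>A\<close> and the elements chosen so far.\<close>

lemma ex_indep_over_list:
  assumes "\<And>C. finite C \<Longrightarrow> c (A \<union> C) \<noteq> UNIV"
  shows "\<exists>cs. length cs = n \<and> distinct cs \<and> indep_over c A (set cs)"
proof (induction n)
  case 0
  then show ?case by (simp add: indep_over_def)
next
  case (Suc n)
  then obtain cs where cs: "length cs = n" "distinct cs" "indep_over c A (set cs)" by blast
  obtain b where b: "b \<notin> c (A \<union> set cs)" using assms[of "set cs"] by auto
  then have "b \<notin> set cs" using pregeometry_extensive by blast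
  then show ?case
    using cs indep_over_insert[OF cs(3) b] by (intro exI[of _ "b # cs"]) simp
qed

end


section \<open>Substitution and renaming of variables\<close>

lemma eval_tm_cong: "(\<And>i. i \<in> fv_tm t \<Longrightarrow> e i = e' i) \<Longrightarrow> eval_tm M e t = eval_tm M e' t"
proof (induction t)
  case (Fn f ts)
  have "map (eval_tm M e) ts = map (eval_tm M e') ts"
    by (rule map_cong[OF refl], rule Fn.IH) (use Fn.prems in auto)
  then show ?case by (simp only: eval_tm.simps)
qed auto

lemma sat_cong: "(\<And>i. i \<in> fv \<phi> \<Longrightarrow> e i = e' i) \<Longrightarrow> sat M e \<phi> \<longleftrightarrow> sat M e' \<phi>"
proof (induction \<phi> arbitrary: e e')
  case (FEq s t)
  then show ?case using eval_tm_cong[of s e e' M] eval_tm_cong[of t e e' M] by simp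
next
  case (FRel R ts)
  then have "map (eval_tm M e) ts = map (eval_tm M e') ts"
    by (auto intro!: eval_tm_cong)
  then show ?case by (simp only: sat.simps)
next
  case (FConj \<phi> \<psi>)
  then show ?case by (metis UnCI fv.simps(4) sat.simps(4))
next
  case (FAll n \<phi>)
  have "sat M (e(n := a)) \<phi> \<longleftrightarrow> sat M (e'(n := a)) \<phi>" for a
    by (rule FAll.IH) (simp add: FAll.prems)
  then show ?case by simp
next
  case (FNeg \<phi>)
  then show ?case by (metis fv.simps(3) sat.simps(3))
qed

definition override :: "(nat \<Rightarrow> 'm) \<Rightarrow> (nat \<Rightarrow> 'm option) \<Rightarrow> nat \<Rightarrow> 'm" where
  "override e \<sigma> i = (case \<sigma> i of None \<Rightarrow> e i | Some m \<Rightarrow> m)"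

lemma eval_inst_tm: "eval_tm M e (inst_tm \<sigma> t) = eval_tm M (override e \<sigma>) t"
  by (induction t) (auto simp: override_def comp_def split: option.split cong: map_cong)

lemma sat_inst: "sat M e (inst \<sigma> \<phi>) \<longleftrightarrow> sat M (override e \<sigma>) \<phi>"
proof (induction \<phi> arbitrary: e \<sigma>)
  case (FAll n \<phi>)
  \<comment> \<open>Erasing \<open>n\<close> from \<open>\<sigma>\<close> lets the quantified value
    at \<open>n\<close> take precedence over the substitution.\<close>
  have "override (e(n := a)) (\<sigma>(n := None)) = (override e \<sigma>)(n := a)" for a
    by (auto simp: override_def fun_eq_iff split: option.split)
  then show ?case by (simp only: inst.simps sat.simps FAll.IH)
qed (auto simp: eval_inst_tm comp_def)

lemma wf_inst_tm: "wf_tm L (inst_tm \<sigma> t) \<longleftrightarrow> wf_tm L t"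
  by (induction t) (auto split: option.split)

lemma wf_inst: "wf_fm L (inst \<sigma> \<phi>) \<longleftrightarrow> wf_fm L \<phi>"
  by (induction \<phi> arbitrary: \<sigma>) (auto simp: wf_inst_tm)

lemma fv_inst_tm: "fv_tm (inst_tm \<sigma> t) = fv_tm t - dom \<sigma>"
  by (induction t) (auto split: option.split)

lemma fv_inst: "fv (inst \<sigma> \<phi>) = fv \<phi> - dom \<sigma>"
  by (induction \<phi> arbitrary: \<sigma>) (auto simp: fv_inst_tm)

lemma params_inst_tm: "params_tm (inst_tm \<sigma> t) \<subseteq> params_tm t \<union> ran \<sigma>"
  by (induction t) (auto split: option.split simp: ran_def)

lemma params_inst: "params (inst \<sigma> \<phi>) \<subseteq> params \<phi> \<union> ran \<sigma>"
proof (induction \<phi> arbitrary: \<sigma>)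
  case (FAll n \<phi>)
  have "ran (\<sigma>(n := None)) \<subseteq> ran \<sigma>" by (auto simp: ran_def)
  then show ?case
    using FAll.IH[of "\<sigma>(n := None)"] unfolding inst.simps params.simps by blast
next
  case (FEq s t)
  then show ?case using params_inst_tm[of \<sigma> s] params_inst_tm[of \<sigma> t] by auto
next
  case (FRel R ts)
  then show ?case using params_inst_tm[of \<sigma>] by fastforce
next
  case (FConj \<phi> \<psi>)
  then show ?case using FConj.IH[of \<sigma>] by auto
qed auto

text \<open>
  Bound variables are renamed along with the free ones, so an injective renaming captures nothing.
\<close>

fun rename_tm :: "(nat \<Rightarrow> nat) \<Rightarrow> ('f, 'm) tm \<Rightarrow> ('f, 'm) tm" where
  "rename_tm \<pi> (Var n) = Var (\<pi> n)"
| "rename_tm \<pi> (Param m) = Param m"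
| "rename_tm \<pi> (Fn f ts) = Fn f (map (rename_tm \<pi>) ts)"

fun rename :: "(nat \<Rightarrow> nat) \<Rightarrow> ('f, 'r, 'm) fm \<Rightarrow> ('f, 'r, 'm) fm" where
  "rename \<pi> (FEq s t) = FEq (rename_tm \<pi> s) (rename_tm \<pi> t)"
| "rename \<pi> (FRel R ts) = FRel R (map (rename_tm \<pi>) ts)"
| "rename \<pi> (FNeg \<phi>) = FNeg (rename \<pi> \<phi>)"
| "rename \<pi> (FConj \<phi> \<psi>) = FConj (rename \<pi> \<phi>) (rename \<pi> \<psi>)"
| "rename \<pi> (FAll n \<phi>) = FAll (\<pi> n) (rename \<pi> \<phi>)"

lemma eval_rename_tm: "eval_tm M e (rename_tm \<pi> t) = eval_tm M (e \<circ> \<pi>) t"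
  by (induction t) (auto simp: comp_def cong: map_cong)

lemma sat_rename: "inj \<pi> \<Longrightarrow> sat M e (rename \<pi> \<phi>) \<longleftrightarrow> sat M (e \<circ> \<pi>) \<phi>"
proof (induction \<phi> arbitrary: e)
  case (FRel R ts)
  then show ?case by (simp add: eval_rename_tm[of M e \<pi>, abs_def] comp_def)
next
  case (FAll n \<phi>)
  have "e(\<pi> n := a) \<circ> \<pi> = (e \<circ> \<pi>)(n := a)" for a
    using FAll.prems by (auto simp: fun_eq_iff inj_eq)
  then show ?case by (simp only: rename.simps sat.simps FAll.IH[OF FAll.prems])
qed (auto simp: eval_rename_tm)

lemma wf_rename_tm: "wf_tm L (rename_tm \<pi> t) \<longleftrightarrow> wf_tm L t"
  by (induction t) auto

lemma wf_rename: "wf_fm L (rename \<pi> \<phi>) \<longleftrightarrow> wf_fm L \<phi>"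
  by (induction \<phi>) (auto simp: wf_rename_tm)

lemma fv_rename_tm: "fv_tm (rename_tm \<pi> t) = \<pi> ` fv_tm t"
  by (induction t) auto

lemma fv_rename: "inj \<pi> \<Longrightarrow> fv (rename \<pi> \<phi>) = \<pi> ` fv \<phi>"
  by (induction \<phi>) (auto simp: fv_rename_tm image_Un image_set_diff inj_eq)

lemma params_rename_tm: "params_tm (rename_tm \<pi> t) = params_tm t"
  by (induction t) auto

lemma params_rename: "params (rename \<pi> \<phi>) = params \<phi>"
  by (induction \<phi>) (auto simp: params_rename_tm)


section \<open>Types of tuples\<close>

definition env :: "'m list \<Rightarrow> nat \<Rightarrow> 'm" where
  "env bs i = (if i < length bs then bs ! i else undefined)"

lemma mem_tp_iff:
  "\<phi> \<in> tp L M A bs \<longleftrightarrow>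
     wf_fm L \<phi> \<and> params \<phi> \<subseteq> A \<and> fv \<phi> \<subseteq> {..<length bs} \<and> sat M (env bs) \<phi>"
  by (simp add: tp_def env_def[abs_def])

text \<open>Renaming variables along \<open>\<pi>\<close> turns membership in the type of the
  permuted tuple into membership in the type of the original one.\<close>

lemma tp_eq_permute_list:
  assumes "tp L M A xs = tp L M A ys" "length xs = length ys" "\<pi> permutes {..<length xs}"
  shows "tp L M A (permute_list \<pi> xs) = tp L M A (permute_list \<pi> ys)"
proof -
  have inj: "inj \<pi>" using assms(3) permutes_inj by blast
  have "\<phi> \<in> tp L M A (permute_list \<pi> zs) \<longleftrightarrow> rename \<pi> \<phi> \<in> tp L M A zs"
    if \<pi>: "\<pi> permutes {..<length zs}" for zs \<phi>
  proof -
    have "env (permute_list \<pi> zs) = env zs \<circ> \<pi>"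
    proof
      fix i
      \<comment> \<open>Since \<open>\<pi>\<close> respects the bound \<open>length zs\<close>, both
        environments take the default \<open>undefined\<close> beyond it.\<close>
      have "\<pi> i < length zs \<longleftrightarrow> i < length zs"
        using permutes_in_image[OF \<pi>, of i] by simp
      then show "env (permute_list \<pi> zs) i = (env zs \<circ> \<pi>) i"
        using permute_list_nth[OF \<pi>] by (simp add: env_def)
    qed
    moreover have "\<pi> ` fv \<phi> \<subseteq> {..<length zs} \<longleftrightarrow> fv \<phi> \<subseteq> {..<length zs}"
      using permutes_in_image[OF \<pi>] by (auto simp: image_subset_iff)
    ultimately show ?thesis
      using inj by (simp add: mem_tp_iff wf_rename fv_rename params_rename sat_rename)
  qed
  then show ?thesis using assms by auto
qed

text \<open>Passes from one-variable formulas with parameters, the form in which \<open>p\<close> is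
  given, to types of tuples whose entry 0 is the realization. The constant environment is harmless,
  as \<open>bs\<close> fills all other free variables.\<close>

lemma sat_inst_y:
  assumes "fv \<phi> \<subseteq> {..length bs}"
  shows "sat M (\<lambda>_. a) (inst_y bs \<phi>) \<longleftrightarrow> sat M (env (a # bs)) \<phi>"
  unfolding inst_y_def sat_inst
proof (rule sat_cong)
  fix i assume "i \<in> fv \<phi>"
  then have "i \<le> length bs" using assms by auto
  then show "override (\<lambda>_. a) (\<lambda>i. case i of 0 \<Rightarrow> None
      | Suc j \<Rightarrow> if j < length bs then Some (bs ! j) else None) i = env (a # bs) i"
    by (cases i) (auto simp: override_def env_def)
qed

lemma inst_y_in_fm1:
  assumes "wf_fm L \<phi>" "fv \<phi> \<subseteq> {..length bs}"
  shows "inst_y bs \<phi> \<in> fm1 L"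
proof -
  have "Suc j \<in> fv \<phi> \<Longrightarrow> j < length bs" for j
    using assms(2) by auto
  then show ?thesis
    using assms(1) unfolding fm1_def inst_y_def
    by (auto simp: wf_inst fv_inst dom_def split: nat.splits)
qed

lemma params_inst_y: "params (inst_y bs \<phi>) \<subseteq> params \<phi> \<union> set bs"
proof -
  have "ran (\<lambda>i. case i of 0 \<Rightarrow> None
      | Suc j \<Rightarrow> if j < length bs then Some (bs ! j) else None) \<subseteq> set bs" (is "ran ?\<sigma> \<subseteq> _")
  proof
    fix x assume "x \<in> ran ?\<sigma>"
    then obtain i where "?\<sigma> i = Some x" by (auto simp: ran_def)
    then show "x \<in> set bs" by (cases i) (auto split: if_splits)
  qed
  then show ?thesis
    unfolding inst_y_def by (intro order_trans[OF params_inst] Un_mono order_refl)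
qed

text \<open>
  In \<open>\<phi>\<close> the variable \<open>0\<close> is to become the parameter \<open>a\<close> while \<open>y\<^sub>i\<close>, number \<open>i\<close>, has to become
  variable \<open>i - 1\<close>, as in \<^const>\<open>tp\<close>; the renaming cycles the variables up to \<open>length bs\<close>.
\<close>

lemma tp_eq_sat_env_Cons:
  assumes "tp L M A b1 = tp L M A b2" "length b1 = length b2"
    and "wf_fm L \<phi>" "params \<phi> \<subseteq> A" "fv \<phi> \<subseteq> {..length b1}" "a \<in> A"
  shows "sat M (env (a # b1)) \<phi> \<longleftrightarrow> sat M (env (a # b2)) \<phi>"
proof -
  let ?n = "length b1"
  define \<pi> where "\<pi> i = (if i = 0 then ?n else if i \<le> ?n then i - 1 else i)" for i
  define \<sigma> where "\<sigma> i = (if i = ?n then Some a else None)" for i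
  have inj: "inj \<pi>" by (auto simp: inj_def \<pi>_def split: if_splits)
  let ?\<psi> = "inst \<sigma> (rename \<pi> \<phi>)"
  have "?\<psi> \<in> tp L M A b \<longleftrightarrow> sat M (env (a # b)) \<phi>" if len: "length b = ?n" for b
  proof -
    have "\<pi> ` fv \<phi> \<subseteq> {..?n}"
      using assms(5) by (auto simp: \<pi>_def)
    moreover have "dom \<sigma> = {?n}" by (auto simp: dom_def \<sigma>_def)
    ultimately have "fv ?\<psi> \<subseteq> {..<?n}"
      using inj by (force simp: fv_inst fv_rename)
    moreover have "params ?\<psi> \<subseteq> A"
      using params_inst[of \<sigma> "rename \<pi> \<phi>"] assms(4,6)
      by (auto simp: params_rename ran_def \<sigma>_def split: if_splits)
    moreover have "sat M (env b) ?\<psi> \<longleftrightarrow> sat M (env (a # b)) \<phi>"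
      unfolding sat_inst sat_rename[OF inj]
    proof (rule sat_cong)
      fix i assume "i \<in> fv \<phi>"
      then have "i \<le> ?n" using assms(5) by auto
      then show "(override (env b) \<sigma> \<circ> \<pi>) i = env (a # b) i"
        by (cases i) (auto simp: override_def env_def \<pi>_def \<sigma>_def len)
    qed
    ultimately show ?thesis
      using assms(3) by (simp add: mem_tp_iff wf_inst wf_rename len)
  qed
  from this[of b1] this[of b2] assms(1,2) show ?thesis by simp
qed


section \<open>Countability\<close>

instance tm :: (countable, countable) countable
  by countable_datatype

instance fm :: (countable, countable, countable) countable
  by countable_datatype

lemma wf_tm_syms: "wf_tm L t \<Longrightarrow> set1_tm t \<subseteq> fun_syms L"
  by (induction t) auto

lemma wf_fm_syms: "wf_fm L \<phi> \<Longrightarrow> set1_fm \<phi> \<subseteq> fun_syms L \<and> set2_fm \<phi> \<subseteq> rel_syms L"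
  by (induction \<phi>) (auto dest: wf_tm_syms)

lemma set2_tm_eq_params: "set2_tm t = params_tm t"
  by (induction t) auto

lemma set3_fm_eq_params: "set3_fm \<phi> = params \<phi>"
  by (induction \<phi>) (auto simp: set2_tm_eq_params)

text \<open>The symbol types may be uncountable, so the symbols of \<open>L\<close> and the elements
  of \<open>X\<close> are first coded injectively by naturals; formulas over naturals form a
  countable datatype.\<close>

lemma countable_formulas_over:
  assumes "countable_language L" "countable X"
  shows "countable {\<phi>. wf_fm L \<phi> \<and> params \<phi> \<subseteq> X}" (is "countable ?S")
proof -
  let ?f = "to_nat_on (fun_syms L)" and ?r = "to_nat_on (rel_syms L)" and ?x = "to_nat_on X"
  have inj: "inj_on ?f (fun_syms L)" "inj_on ?r (rel_syms L)" "inj_on ?x X"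
    using assms by (auto simp: countable_language_def)
  have "inj_on (map_fm ?f ?r ?x) ?S"
  proof (rule inj_onI)
    fix \<phi> \<psi> assume S: "\<phi> \<in> ?S" "\<psi> \<in> ?S" and "map_fm ?f ?r ?x \<phi> = map_fm ?f ?r ?x \<psi>"
    then show "\<phi> = \<psi>"
      by (elim fm.inj_map_strong[rotated 3])
        (use S wf_fm_syms[of L \<phi>] wf_fm_syms[of L \<psi>] inj in
          \<open>auto simp: set3_fm_eq_params dest: inj_onD\<close>)
  qed
  then show ?thesis
    using countable_image_inj_on[OF countableI_type] by blast
qed


section \<open>The generic type\<close>

context
  fixes L :: "('f, 'r) language" and M :: "('f, 'r, 'm) struct" and p :: "('f, 'r, 'm) fm set"
  assumes quasiminimal: "quasiminimal L M" and generic: "p = generic_type L M"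
begin

text \<open>There are countably many formulas over \<open>X\<close>, and each one in
  \<open>p\<close> fails only on a countable set.\<close>

lemma countable_cl:
  assumes "countable X"
  shows "countable (cl M p X)"
proof -
  let ?S = "{\<phi> \<in> p. params \<phi> \<subseteq> X}"
  have "?S \<subseteq> {\<phi>. wf_fm L \<phi> \<and> params \<phi> \<subseteq> X}"
    by (auto simp: generic generic_type_def fm1_def)
  then have "countable ?S"
    using countable_formulas_over[of L X] assms quasiminimal countable_subset
    by (fastforce simp: quasiminimal_def)
  moreover have "cl M p X = (\<Union>\<phi>\<in>?S. - defined_set M \<phi>)"
    unfolding set_eq_iff mem_cl_iff by blast
  ultimately show ?thesis
    by (auto simp: generic generic_type_def)
qed

lemma countable_ccl:
  assumes "countable X"
  shows "countable (ccl M p X)"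
proof -
  have "countable ((cl M p ^^ n) X)" for n
    by (induction n) (use assms countable_cl in auto)
  then show ?thesis by (simp add: ccl_def)
qed

lemma ccl_countable_neq_UNIV: "countable X \<Longrightarrow> ccl M p X \<noteq> UNIV"
  using countable_ccl[of X] quasiminimal by (auto simp: quasiminimal_def)

lemma realizes_notin_ccl:
  assumes "a \<notin> ccl M p X"
  shows "realizes M a (restrict_type p X)"
proof -
  have "cl M p X \<subseteq> ccl M p X"
    unfolding ccl_def using UN_upper[of 1 UNIV "\<lambda>n. (cl M p ^^ n) X"] by simp
  then show ?thesis using assms by (auto simp: cl_def)
qed

text \<open>Completeness of \<open>p\<close>: by quasiminimality a formula outside \<open>p\<close>
  defines a countable set, so its negation is in \<open>p\<close> and holds at
  \<open>a\<close>.\<close>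

lemma realizes_iff_mem:
  assumes "realizes M a (restrict_type p X)" "\<phi> \<in> fm1 L" "params \<phi> \<subseteq> X"
  shows "sat M (\<lambda>_. a) \<phi> \<longleftrightarrow> \<phi> \<in> p"
proof
  assume "\<phi> \<in> p"
  then show "sat M (\<lambda>_. a) \<phi>"
    using assms by (auto simp: realizes_def restrict_type_def defined_set_def)
next
  assume sat: "sat M (\<lambda>_. a) \<phi>"
  show "\<phi> \<in> p"
  proof (rule ccontr)
    assume "\<phi> \<notin> p"
    moreover have "countable (defined_set M \<phi>) \<or> countable (- defined_set M \<phi>)"
      using quasiminimal assms(2) by (auto simp: quasiminimal_def definable_def)
    ultimately have "countable (defined_set M \<phi>)"
      using assms(2) by (auto simp: generic generic_type_def)
    moreover have "- defined_set M (FNeg \<phi>) = defined_set M \<phi>"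
      by (auto simp: defined_set_def)
    ultimately have "FNeg \<phi> \<in> p"
      using assms(2) by (simp add: generic generic_type_def fm1_def)
    then have "a \<in> defined_set M (FNeg \<phi>)"
      using assms(1,3) by (auto simp: realizes_def restrict_type_def)
    then show False using sat by (simp add: defined_set_def)
  qed
qed

lemma ex_realizes:
  assumes "countable X"
  shows "\<exists>a. realizes M a (restrict_type p X)"
  using ccl_countable_neq_UNIV[OF assms] realizes_notin_ccl by blast

lemma FIff_mem_iff:
  assumes "realizes M a (restrict_type p X)" "\<phi> \<in> fm1 L" "\<psi> \<in> fm1 L"
    and "params \<phi> \<subseteq> X" "params \<psi> \<subseteq> X"
  shows "FIff \<phi> \<psi> \<in> p \<longleftrightarrow> (sat M (\<lambda>_. a) \<phi> \<longleftrightarrow> sat M (\<lambda>_. a) \<psi>)"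
proof -
  have "FIff \<phi> \<psi> \<in> fm1 L" "params (FIff \<phi> \<psi>) \<subseteq> X"
    using assms by (auto simp: FIff_def fm1_def)
  from realizes_iff_mem[OF assms(1) this] show ?thesis
    by (auto simp: FIff_def)
qed

text \<open>One realization of \<open>p\<close> over the finitely many parameters decides
  \<open>\<phi>\<close>, \<open>\<psi>\<close> and their equivalence at once.\<close>

lemma FIff_memD:
  assumes "FIff \<phi> \<psi> \<in> p" "\<phi> \<in> fm1 L" "\<psi> \<in> fm1 L"
  shows "\<phi> \<in> p \<longleftrightarrow> \<psi> \<in> p"
proof -
  let ?X = "params \<phi> \<union> params \<psi>"
  have "countable ?X" by (simp add: finite_params countable_finite)
  then obtain a where a: "realizes M a (restrict_type p ?X)" using ex_realizes by blast
  show ?thesis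
    using FIff_mem_iff[OF a] realizes_iff_mem[OF a] assms by auto
qed

section \<open>Non-splitting over an infinite independent set\<close>

lemma does_not_split_if_infinite_indep:
  assumes pre: "pregeometry (ccl M p)"
    and I: "infinite I" "indep_over (ccl M p) {} I"
  shows "does_not_split L M p I"
  unfolding does_not_split_def
proof (intro allI impI, elim conjE)
  fix n and \<phi> :: "('f, 'r, 'm) fm" and b1 b2
  assume \<phi>: "wf_fm L \<phi>" "params \<phi> \<subseteq> I" "fv \<phi> \<subseteq> {..n}"
    and len: "length b1 = n" "length b2 = n" and eq: "tp L M I b1 = tp L M I b2"
  define F where "F = params \<phi> \<union> set b1 \<union> set b2"
  have "finite F" by (simp add: F_def finite_params)
  then have "\<not> I \<subseteq> ccl M p ({} \<union> F)"
    using infinite_indep_not_spanned[OF pre _ I] by blast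
  then obtain a where a: "a \<in> I" "a \<notin> ccl M p F" by auto
  note real = realizes_notin_ccl[OF a(2)]
  have "params (inst_y b1 \<phi>) \<subseteq> F" "params (inst_y b2 \<phi>) \<subseteq> F"
    using params_inst_y[of b1 \<phi>] params_inst_y[of b2 \<phi>] by (auto simp: F_def)
  moreover have "inst_y b1 \<phi> \<in> fm1 L" "inst_y b2 \<phi> \<in> fm1 L"
    using \<phi> len by (simp_all add: inst_y_in_fm1)
  \<comment> \<open>The element \<open>a\<close> has two roles: as a member of \<open>I\<close> it
    may be a parameter, so equality of types makes both instances agree at \<open>a\<close>; being
    generic over \<open>F\<close>, it decides whether the equivalence is in
    \<open>p\<close>.\<close>
  ultimately show "FIff (inst_y b1 \<phi>) (inst_y b2 \<phi>) \<in> p"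
    using FIff_mem_iff[OF real] tp_eq_sat_env_Cons[OF eq _ \<phi>(1,2) _ a(1)] \<phi>(3) len
    by (simp add: sat_inst_y)
qed


section \<open>Finite weak Morley sequences\<close>

text \<open>The latest element comes first, so that it is the variable \<open>x\<close> (number 0) of \<^const>\<open>inst_y\<close>.\<close>

fun Morley_list :: "'m set \<Rightarrow> 'm list \<Rightarrow> bool" where
  "Morley_list A [] \<longleftrightarrow> True"
| "Morley_list A (b # bs) \<longleftrightarrow>
     realizes M b (restrict_type p (A \<union> set bs)) \<and> Morley_list A bs"

text \<open>Induction on length: once the tails have equal types, non-splitting gives the same
  answer for both instances in \<open>p\<close>, and the heads, realizing \<open>p\<close> over
  their tails, obey that answer.\<close>

lemma tp_Morley_list_eq:
  assumes "does_not_split L M p A"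
  shows "Morley_list A bs \<Longrightarrow> Morley_list A cs \<Longrightarrow> length bs = length cs \<Longrightarrow>
    tp L M A bs = tp L M A cs"
proof (induction bs cs rule: list_induct2')
  case (4 b bs c cs)
  then have eq: "tp L M A bs = tp L M A cs" and len: "length bs = length cs" by auto
  have "\<phi> \<in> tp L M A (b # bs) \<longleftrightarrow> \<phi> \<in> tp L M A (c # cs)" for \<phi>
  proof (cases "wf_fm L \<phi> \<and> params \<phi> \<subseteq> A \<and> fv \<phi> \<subseteq> {..length bs}")
    case True
    then have fm1: "inst_y bs \<phi> \<in> fm1 L" "inst_y cs \<phi> \<in> fm1 L"
      using len by (simp_all add: inst_y_in_fm1)
    have "FIff (inst_y bs \<phi>) (inst_y cs \<phi>) \<in> p"
      using assms True eq len unfolding does_not_split_def by metis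
    then have mem: "inst_y bs \<phi> \<in> p \<longleftrightarrow> inst_y cs \<phi> \<in> p"
      using FIff_memD fm1 by blast
    have "params (inst_y bs \<phi>) \<subseteq> A \<union> set bs" "params (inst_y cs \<phi>) \<subseteq> A \<union> set cs"
      using params_inst_y[of bs \<phi>] params_inst_y[of cs \<phi>] True by auto
    then have "sat M (\<lambda>_. b) (inst_y bs \<phi>) \<longleftrightarrow> sat M (\<lambda>_. c) (inst_y cs \<phi>)"
      using "4.prems"(1,2) mem fm1
        realizes_iff_mem[of b "A \<union> set bs"] realizes_iff_mem[of c "A \<union> set cs"] by simp
    then have "sat M (env (b # bs)) \<phi> \<longleftrightarrow> sat M (env (c # cs)) \<phi>"
      using True len by (simp add: sat_inst_y)
    then show ?thesis using len by (simp add: mem_tp_iff)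
  next
    \<comment> \<open>Such a formula is in neither type; \<open>{..length bs}\<close> consists of
      the numbers below \<open>length (b # bs)\<close>.\<close>
    case False
    then show ?thesis using len by (auto simp: mem_tp_iff lessThan_Suc_atMost)
  qed
  then show ?case by blast
qed auto

text \<open>Only the set of entries matters for independence, so this applies to every rearrangement
  of \<open>cs\<close> as well.\<close>

lemma Morley_list_if_indep:
  assumes "pregeometry (ccl M p)"
  shows "distinct cs \<Longrightarrow> indep_over (ccl M p) A (set cs) \<Longrightarrow> Morley_list A cs"
proof (induction cs)
  case (Cons b cs)
  have "indep_over (ccl M p) A (set cs)"
    unfolding indep_over_def
  proof
    fix x assume x: "x \<in> set cs"
    have "A \<union> (set cs - {x}) \<subseteq> A \<union> (set (b # cs) - {x})" by auto
    then show "x \<notin> ccl M p (A \<union> (set cs - {x}))"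
      using Cons.prems(2) x pregeometry_mono[OF assms] unfolding indep_over_def
      by (meson list.set_intros(2) subsetD)
  qed
  moreover have "b \<notin> ccl M p (A \<union> set cs)"
    using Cons.prems by (simp add: indep_over_def)
  ultimately show ?case using Cons realizes_notin_ccl by simp
qed simp

text \<open>Splitting off the \<open>r\<close>-greatest index of \<open>F\<close> repeatedly lists
  \<open>F\<close> in decreasing order, matching the convention of \<open>Morley_list\<close> that
  the latest element comes first.\<close>

lemma weak_Morley_sorted_list:
  assumes "weak_Morley L M p A r a" "finite F" "F \<subseteq> Field r"
  shows "\<exists>js. distinct js \<and> set js = F \<and> Morley_list A (map a js)"
  using assms(2,3)
proof (induction F rule: finite_psubset_induct)
  case (psubset F)
  show ?case
  proof (cases "F = {}")
    case True
    then show ?thesis by simp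
  next
    case False
    have lin: "Linear_order r" using assms(1) by (auto simp: weak_Morley_def well_order_on_def)
    have "\<exists>m\<in>F. F - {m} \<subseteq> underS r m"
      using psubset.hyps False psubset.prems
    proof (induction F rule: finite_ne_induct)
      case (insert x F)
      then obtain m where m: "m \<in> F" "F - {m} \<subseteq> underS r m" by auto
      then have "x \<noteq> m" using insert by auto
      moreover have "x \<in> Field r" "m \<in> Field r" using insert m by auto
      ultimately consider "(x, m) \<in> r" | "(m, x) \<in> r"
        using lin by (auto simp: linear_order_on_def total_on_def)
      then show ?case
      proof cases
        case 1
        then show ?thesis using m \<open>x \<noteq> m\<close> by (intro bexI[of _ m]) (auto simp: underS_def)
      next
        case 2
        have "trans r" using lin by (auto simp: order_on_defs)
        then have "F \<subseteq> underS r x"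
          using 2 m insert.hyps by (auto simp: underS_def dest: transD)
        then show ?thesis by auto
      qed
    qed auto
    then obtain m where m: "m \<in> F" "F - {m} \<subseteq> underS r m" by blast
    then have less: "F - {m} \<subset> F" and sub: "F - {m} \<subseteq> Field r"
      using psubset.prems m(1) by auto
    then obtain js where js: "distinct js" "set js = F - {m}" "Morley_list A (map a js)"
      using psubset.IH[OF less sub] by (elim exE conjE)
    have "realizes M (a m) (restrict_type p (A \<union> a ` underS r m))"
      using assms(1) m psubset.prems by (auto simp: weak_Morley_def)
    moreover have "A \<union> a ` set js \<subseteq> A \<union> a ` underS r m"
      using m js(2) by auto
    ultimately have "realizes M (a m) (restrict_type p (A \<union> a ` set js))"
      \<comment> \<open>Monotonicity of \<open>cl\<close> in contrapositive form: realizing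
        \<open>p\<close> over more parameters implies realizing it over fewer.\<close>
      using cl_mono unfolding cl_def by blast
    then show ?thesis
      using js m by (intro exI[of _ "m # js"]) auto
  qed
qed

section \<open>Symmetry of the generic type\<close>

lemma symmetric_generic_type:
  assumes pre: "pregeometry (ccl M p)"
  shows "symmetric_type L M p"
  unfolding symmetric_type_def
proof (intro allI impI, elim conjE)
  fix A and r :: "'m rel" and a
  assume based: "based_on L M p A" and Morley: "weak_Morley L M p A r a"
  have split: "does_not_split L M p A" using based by (simp add: based_on_def)
  have ex: "\<exists>cs. length cs = n \<and> distinct cs \<and> indep_over (ccl M p) A (set cs)" for n
    using based ex_indep_over_list[OF pre, of A n] unfolding based_on_def by blast
  \<comment> \<open>An independent \<open>cs\<close> serves as a common yardstick: two index tuples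
    of the same length are each compared with the same \<open>cs\<close>.\<close>
  have tp: "tp L M A (map a is) = tp L M A cs"
    if "is": "set is \<subseteq> Field r" "distinct is"
      and cs: "length cs = length is" "distinct cs" "indep_over (ccl M p) A (set cs)" for "is" cs
  proof -
    obtain js where js: "distinct js" "set js = set is" "Morley_list A (map a js)"
      using weak_Morley_sorted_list[OF Morley _ "is"(1)] by auto
    have mset: "mset (map a is) = mset (map a js)"
      using set_eq_iff_mset_eq_distinct[OF "is"(2) js(1)] js(2) by simp
    have len: "length js = length is" using mset_eq_length[OF mset] by simp
    obtain \<pi> where \<pi>: "\<pi> permutes {..<length (map a js)}" "permute_list \<pi> (map a js) = map a is"
      using mset_eq_permutation[OF mset] by blast
    have \<pi>': "\<pi> permutes {..<length cs}" using \<pi>(1) cs(1) len by simp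
    have "tp L M A (map a js) = tp L M A cs"
      using tp_Morley_list_eq[OF split js(3) Morley_list_if_indep[OF pre cs(2,3)]] cs(1) len
      by simp
    then have "tp L M A (map a is) = tp L M A (permute_list \<pi> cs)"
      using tp_eq_permute_list[OF _ _ \<pi>(1), of L M A cs] \<pi>(2) cs(1) len by simp
    \<comment> \<open>Permuting \<open>cs\<close> keeps its set of entries, so both lists are
      independent and hence Morley lists of equal length.\<close>
    also have "\<dots> = tp L M A cs"
      using cs(2,3) \<pi>'
      by (intro tp_Morley_list_eq[OF split] Morley_list_if_indep[OF pre]) simp_all
    finally show ?thesis .
  qed
  show "totally_indiscernible L M A r a"
    unfolding totally_indiscernible_def using tp ex by metis
qed

section \<open>A countable free sequence as base\<close>

lemma ex_free_sequence: "\<exists>e :: nat \<Rightarrow> 'm. \<forall>n. e n \<notin> ccl M p (e ` {..<n})"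
proof (rule dependent_wellorder_choice)
  fix r n and f g :: "nat \<Rightarrow> 'm"
  \<comment> \<open>The choice principle requires the condition at stage \<open>n\<close> to depend
    only on earlier values.\<close>
  assume "\<And>y. y < n \<Longrightarrow> f y = g y"
  then have "f ` {..<n} = g ` {..<n}" by auto
  then show "(r \<notin> ccl M p (f ` {..<n})) = (r \<notin> ccl M p (g ` {..<n}))" by simp
next
  fix n and f :: "nat \<Rightarrow> 'm"
  show "\<exists>r. r \<notin> ccl M p (f ` {..<n})"
    using ccl_countable_neq_UNIV[of "f ` {..<n}"] by (auto simp: countable_finite)
qed

end

theorem corollary4:
  fixes L :: "('f, 'r) language"
    and M :: "('f, 'r, 'm) struct"
    and p :: "('f, 'r, 'm) fm set"
  assumes "quasiminimal L M"
    and "p = generic_type L M"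
    and "pregeometry (ccl M p)"
  shows "countably_based L M p \<and> symmetric_type L M p \<and>
    (\<exists>(r :: 'm rel) a. infinite (Field r) \<and> countable (Field r) \<and> ccl_free M p r a \<and>
       based_on L M p (a ` Field r))"
proof -
  obtain e :: "nat \<Rightarrow> 'm" where e: "\<And>n. e n \<notin> ccl M p (e ` {..<n})"
    using ex_free_sequence[OF assms(1,2)] by blast
  have inj: "inj e" and indep: "indep_over (ccl M p) {} (range e)"
    using free_sequence_indep[OF assms(3), of e] e by blast+
  have inf: "infinite (range e)" using inj range_inj_infinite by blast
  have based: "based_on L M p (range e)"
    unfolding based_on_def
    using does_not_split_if_infinite_indep[OF assms inf indep] ccl_countable_neq_UNIV[OF assms(1,2)]
    by (simp add: psubset_eq countable_finite)
  \<comment> \<open>The index type in the conclusion is \<open>'m\<close>, so the order of the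
    naturals is carried to \<open>range e\<close> along \<open>e\<close>; the sequence itself
    becomes \<open>id\<close>.\<close>
  define r where "r = dir_image natLeq e"
  have Field: "Field r = range e"
    by (simp add: r_def dir_image_Field Field_natLeq)
  have "Well_order r"
    unfolding r_def using inj natLeq_Well_order
    by (intro Well_order_dir_image) (auto simp: Field_natLeq)
  moreover have "underS r (e n) = e ` {..<n}" for n
    using inj by (auto simp: r_def underS_def dir_image_def natLeq_def inj_eq)
  ultimately have "ccl_free M p r id"
    using e by (simp add: ccl_free_def Field)
  then have "\<exists>(r :: 'm rel) a. infinite (Field r) \<and> countable (Field r) \<and> ccl_free M p r a \<and>
       based_on L M p (a ` Field r)"
    using inf based by (intro exI[of _ r] exI[of _ id]) (simp add: Field)
  moreover have "countably_based L M p"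
    unfolding countably_based_def using based by (intro exI[of _ "range e"]) simp
  ultimately show ?thesis
    using symmetric_generic_type[OF assms] by blast
qed

end
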